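(* Let $(\lambda,v)$ be a simple eigenpair of the problem $A(v)v=\lambda v$ with $\frac12 v^Tv=1$, let $V\in\mathbb{R}^{n\times(n-1)}$ be a full rank matrix whose columns are orthogonal to $v$, and let $w_1,\dots,w_m\ge0$ be given weights. Then the normwise eigenvector condition number is given by $$\kappa(v)=\left\|V\left(V^T(J(v)-\lambda I)V\right)^{-1}V^T\right\|_2\left(\sum_{i=1}^m|f_i(v)|\,w_i\right),$$ where $\|\cdot\|_2$ is the spectral norm. This holds whether the perturbation matrices in the definition of $\kappa(v)$ are measured in the spectral norm or in the Frobenius norm.
   Context: Setting. Let $n,m$ be positive integers, and let $A:\mathbb{R}^n\to\mathbb{R}^{n\times n}$ be of the form $A(v)=\sum_{i=1}^m f_i(v)A_i$, where each $A_i\in\mathbb{R}^{n\times n}$ is symmetric and each $f_i:\mathbb{R}^n\to\mathbb{R}$ is scaling invariant, i.e. $f_i(\alpha x)=f_i(x)$ for all $x\in\mathbb{R}^n$ and $\alpha\in\mathbb{R}\setminus\{0\}$, and continuously differentiable on $\mathbb{R}^n\setminus\{0\}$. Hence $A(v)$ is symmetric, $A(\alpha x)=A(x)$ for $\alpha\ne0$, and $A$ is continuously differentiable on $\mathbb{R}^n\setminus\{0\}$. An eigenpair is $(\lambda,v)\in\mathbb{R}\times(\mathbb{R}^n\setminus\{0\})$ with $A(v)v=\lambda v$. The Jacobian is $J(v):=\frac{\partial}{\partial v}\left(A(v)v\right)\in\mathbb{R}^{n\times n}$. (By scaling invariance $J(v)v=A(v)v$, so $v$ is an eigenvector of $J(v)$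 with eigenvalue $\lambda$.) The eigenpair $(\lambda,v)$ is called simple if $\lambda$ is a simple (algebraic multiplicity one) eigenvalue of the matrix $J(v)$ with eigenvector $v$. For a simple eigenpair and $V$ as in the claim, the matrix $V^T(J(v)-\lambda I)V$ is nonsingular. Perturbations. Fix matrices $E_1,\dots,E_m\in\mathbb{R}^{n\times n}$. For a simple eigenpair $(\lambda,v)$ with $\frac12v^Tv=1$, the implicit function theorem gives an open set $\mathcal U\subset\mathbb{R}$ containing $0$ and unique differentiable functions $\lambda(\varepsilon),v(\varepsilon)$ on $\mathcal U$ with $\lambda(0)=\lambda$, $v(0)=v$ and, for all $\varepsilon\in\mathcal U$, $$\Big(A(v(\varepsilon))+\varepsilon\sum_{i=1}^m f_i(v(\varepsilon))E_i\Big)v(\varepsilon)=\lambda(\varepsilon)v(\varepsilon),\qquad \tfrac12 v(\varepsilon)^Tv(\varepsilon)=1 .$$ Write $v'=v'(0)$ (it depends on $E_1,\dots,E_m$). Definition. Given weights $w_i\ge0$, $$\kappa(v)=\sup\left\{\frac{\|v'\|}{\|v\|}:\ E_i\in\mathbb{R}^{n\times n},\ \|E_i\|\le w_i,\ i=1,\dots,m\right\},$$ where the matrix norm on the $E_i$ is either the spectral norm or the Frobenius norm. For vectors, $\|\cdot\|$ is the Euclidean norm. *)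

theory Defs
  imports "HOL-Analysis.Analysis" "HOL-Computational_Algebra.Polynomial"
begin

definition continuously_differentiable_on ::
    "('a::real_normed_vector \<Rightarrow> 'b::real_normed_vector) \<Rightarrow> 'a set \<Rightarrow> bool" where
  "continuously_differentiable_on g S \<longleftrightarrow>
     (\<exists>g' :: 'a \<Rightarrow> 'a \<Rightarrow>\<^sub>L 'b.
        (\<forall>x\<in>S. (g has_derivative blinfun_apply (g' x)) (at x)) \<and> continuous_on S g')"

definition scaling_invariant :: "('a::real_vector \<Rightarrow> 'b) \<Rightarrow> bool" where
  "scaling_invariant g \<longleftrightarrow> (\<forall>x. \<forall>\<alpha>. \<alpha> \<noteq> 0 \<longrightarrow> g (\<alpha> *\<^sub>R x) = g x)"

definition spectral_norm :: "real^'n^'m \<Rightarrow> real" where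
  "spectral_norm M = onorm (\<lambda>x. M *v x)"

definition frobenius_norm :: "real^'n^'m \<Rightarrow> real" where
  "frobenius_norm M = sqrt (\<Sum>i\<in>UNIV. \<Sum>j\<in>UNIV. (M $ i $ j)\<^sup>2)"

lemma frobenius_norm_eq_norm: "frobenius_norm M = norm M"
  by (simp add: frobenius_norm_def norm_vec_def L2_set_def real_sqrt_pow2 sum_nonneg)

definition charpoly :: "real^'n^'n \<Rightarrow> real poly" where
  "charpoly M = det (\<chi> i j. (if i = j then [:0, 1:] else 0) - [:M $ i $ j:])"

definition lin_comb :: "('m::finite \<Rightarrow> real^'n \<Rightarrow> real) \<Rightarrow> ('m \<Rightarrow> real^'n^'n) \<Rightarrow> real^'n \<Rightarrow> real^'n^'n" where
  "lin_comb f B x = (\<Sum>i\<in>UNIV. f i x *\<^sub>R B i)"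

definition eigenpair :: "(real^'n \<Rightarrow> real^'n^'n) \<Rightarrow> real \<Rightarrow> real^'n \<Rightarrow> bool" where
  "eigenpair A \<mu> v \<longleftrightarrow> v \<noteq> 0 \<and> A v *v v = \<mu> *\<^sub>R v"

definition eig_jacobian :: "(real^'n \<Rightarrow> real^'n^'n) \<Rightarrow> real^'n \<Rightarrow> real^'n^'n" where
  "eig_jacobian A v = jacobian (\<lambda>x. A x *v x) (at v)"

text \<open>The order of \<open>\<mu>\<close> as a root of the characteristic polynomial is its algebraic
  multiplicity as an eigenvalue.\<close>

definition simple_eigenpair :: "(real^'n \<Rightarrow> real^'n^'n) \<Rightarrow> real \<Rightarrow> real^'n \<Rightarrow> bool" where
  "simple_eigenpair A \<mu> v \<longleftrightarrow>
     eigenpair A \<mu> v \<and> eig_jacobian A v *v v = \<mu> *\<^sub>R v \<and>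
     order \<mu> (charpoly (eig_jacobian A v)) = 1"

definition perturbed_branch ::
    "('m::finite \<Rightarrow> real^'n \<Rightarrow> real) \<Rightarrow> ('m \<Rightarrow> real^'n^'n) \<Rightarrow> ('m \<Rightarrow> real^'n^'n) \<Rightarrow> real \<Rightarrow> real^'n
     \<Rightarrow> real set \<Rightarrow> (real \<Rightarrow> real) \<Rightarrow> (real \<Rightarrow> real^'n) \<Rightarrow> bool" where
  "perturbed_branch f A E \<mu> v U l u \<longleftrightarrow>
     open U \<and> 0 \<in> U \<and> l differentiable_on U \<and> u differentiable_on U \<and> l 0 = \<mu> \<and> u 0 = v \<and>
     (\<forall>\<epsilon>\<in>U. (lin_comb f A (u \<epsilon>) + \<epsilon> *\<^sub>R lin_comb f E (u \<epsilon>)) *v u \<epsilon> = l \<epsilon> *\<^sub>R u \<epsilon> \<and>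
            (u \<epsilon> \<bullet> u \<epsilon>) / 2 = 1)"

text \<open>The derivative \<open>v'(0)\<close> of the perturbed eigenvector. At a simple normalized eigenpair the
  implicit function theorem yields exactly one value; otherwise it is unspecified.\<close>

definition eigvec_deriv ::
    "('m::finite \<Rightarrow> real^'n \<Rightarrow> real) \<Rightarrow> ('m \<Rightarrow> real^'n^'n) \<Rightarrow> ('m \<Rightarrow> real^'n^'n) \<Rightarrow> real \<Rightarrow> real^'n
     \<Rightarrow> real^'n" where
  "eigvec_deriv f A E \<mu> v =
     (THE v'. \<exists>U l u. perturbed_branch f A E \<mu> v U l u \<and> (u has_vector_derivative v') (at 0))"

text \<open>\<open>N\<close> is the norm in which the perturbation matrices are measured. The supremum is taken in the
  extended reals, so that a finite value asserts boundedness.\<close>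

definition eigvec_cond ::
    "(real^'n^'n \<Rightarrow> real) \<Rightarrow> ('m::finite \<Rightarrow> real) \<Rightarrow> ('m \<Rightarrow> real^'n \<Rightarrow> real) \<Rightarrow> ('m \<Rightarrow> real^'n^'n)
     \<Rightarrow> real \<Rightarrow> real^'n \<Rightarrow> ereal" where
  "eigvec_cond N w f A \<mu> v =
     Sup {ereal (norm (eigvec_deriv f A E \<mu> v) / norm v) | E. \<forall>i. N (E i) \<le> w i}"

end

theory Submission imports Defs begin

text \<open>
  Differentiating the perturbed eigenvalue equation and the normalization at \<open>\<epsilon> = 0\<close> gives
  \<open>(J - \<mu>) v' + b = \<lambda>' v\<close> and \<open>v \<bullet> v' = 0\<close>, where \<open>b = (\<Sum>i. f\<^sub>i(v) E\<^sub>i) v\<close>.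
  Algebraic simplicity says that \<open>(J - \<mu>) z \<in> span {v}\<close> with \<open>z \<bottom> v\<close> forces \<open>z = 0\<close>:
  otherwise \<open>v, z\<close> lie in the generalized eigenspace of \<open>\<mu>\<close>, of dimension one. This single fact makes the linear
  system uniquely solvable, supplies the nonsingular derivative needed for the inverse function
  theorem (hence the existence of the branch), and makes \<open>V\<^sup>T (J - \<mu>) V\<close> invertible, so that
  \<open>v' = - V (V\<^sup>T (J - \<mu>) V)\<^sup>-\<^sup>1 V\<^sup>T b\<close>. The upper bound for \<open>\<kappa>\<close> is then the triangle inequality,
  and it is attained at the rank-one matrices \<open>E\<^sub>i = sgn (f\<^sub>i(v)) w\<^sub>i x v\<^sup>T / \<parallel>v\<parallel>\<close>, whose spectral and
  Frobenius norms agree, with \<open>x\<close> a unit vector on which \<open>V (V\<^sup>T (J - \<mu>) V)\<^sup>-\<^sup>1 V\<^sup>T\<close> attains its norm.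
\<close>

section \<open>Characteristic polynomial and algebraic multiplicity\<close>

lemma poly_det: "poly (det P) x = det (\<chi> i j. poly (P $ i $ j) x)"
  for P :: "'a::comm_ring_1 poly^'n^'n"
  by (simp add: det_def poly_sum poly_prod of_int_poly)

lemma mat_vector_mult: "mat c *v y = c *\<^sub>R y" for y :: "real^'n"
  by (simp add: vec_eq_iff matrix_vector_mult_def mat_def if_distrib [of "\<lambda>x. x * _"] cong: if_cong)

text \<open>For a real \<open>x\<close> above an operator bound of \<open>M\<close> the matrix
  \<open>x I - M\<close> is injective, so the polynomial takes a nonzero value there. Additivity of
  \<open>order\<close> over products depends on this.\<close>

lemma charpoly_neq_0: "charpoly M \<noteq> 0" for M :: "real^'n^'n"
proof -
  obtain K where K: "\<And>y. norm (M *v y) \<le> norm y * K"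
    using bounded_linear.bounded [OF matrix_vector_mul_bounded_linear] by blast
  define x where "x = \<bar>K\<bar> + 1"
  have "inj ((*v) (mat x - M))"
  proof (rule linear_injective_0 [THEN iffD2, rule_format])
    fix y assume "(mat x - M) *v y = 0"
    then have "x *\<^sub>R y = M *v y"
      by (simp add: matrix_vector_mult_diff_rdistrib mat_vector_mult)
    then have "norm y * x \<le> norm y * K"
      using K [of y] by (metis abs_ge_zero abs_of_nonneg add_nonneg_nonneg mult.commute norm_scaleR x_def zero_le_one)
    then show "y = 0"
      by (auto simp: x_def mult_le_cancel_left)
  qed (rule matrix_vector_mul_linear)
  then have "det (mat x - M) \<noteq> 0"
    by (simp add: invertible_det_nz [symmetric] invertible_left_inverse matrix_left_invertible_injective)
  also have "det (mat x - M) = poly (charpoly M) x"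
    unfolding charpoly_def poly_det by (intro arg_cong [of _ _ det]) (simp add: vec_eq_iff mat_def)
  finally show ?thesis by auto
qed

lemma order_charpoly_neq_1:
  fixes M :: "real^'n^'n"
  assumes Mv: "M *v v = \<mu> *\<^sub>R v" and Mz: "M *v z = \<mu> *\<^sub>R z + c *\<^sub>R v"
    and indep: "independent {v, z}" and "v \<noteq> z"
  shows "order \<mu> (charpoly M) \<noteq> 1"
proof -
  define B where "B = extend_basis {v, z}"
  have B: "independent B" "{v, z} \<subseteq> B" "span B = UNIV"
    unfolding B_def using indep
    by (simp_all add: independent_extend_basis extend_basis_superset span_extend_basis del: insert_subset)
  have "card B = CARD('n)"
    using B by (metis dim_UNIV dim_span dim_eq_card_independent DIM_cart DIM_real mult.right_neutral)
  then obtain h :: "'n \<Rightarrow> real^'n" where h: "bij_betw h UNIV B"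
    by (metis B(1) finite_class.finite_UNIV independent_bound finite_same_card_bij)
  obtain i j where ij: "h i = v" "h j = z"
    using h B(2) by (metis bij_betw_imp_surj_on imageE insert_subset)
  then have "i \<noteq> j" using \<open>v \<noteq> z\<close> by auto
  define P :: "real^'n^'n" where "P = (\<chi> k. h k)"
  have rows: "rows P = B"
    using h by (auto simp: rows_def row_def P_def bij_betw_def)
  have "det P \<noteq> 0"
    using B(3) rows
    by (metis invertible_det_nz invertible_left_inverse matrix_left_invertible_span_rows)
  define Pp :: "real poly^'n^'n" where "Pp = (\<chi> k r. [:P $ k $ r:])"
  define C :: "real poly^'n^'n" where "C = (\<chi> i j. (if i = j then [:0, 1:] else 0) - [:M $ i $ j:])"
  define vp zp :: "real poly^'n" where "vp = (\<chi> r. [:v $ r:])" and "zp = (\<chi> r. [:z $ r:])"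
  define L :: "real poly" where "L = [:-\<mu>, 1:]"
  \<comment> \<open>The rows of \<open>R\<close> are \<open>(X - M) (h k)\<close>; rows \<open>i\<close> and \<open>j\<close> yield one factor \<open>X - \<mu>\<close> each.\<close>
  define R where "R = Pp ** transpose C"
  have charC: "det C = charpoly M" by (simp add: C_def charpoly_def)
  have detR: "det R = det Pp * charpoly M"
    by (simp add: R_def det_mul charC)
  have Rkr: "R $ k $ r = [:0, 1:] * [:h k $ r:] - [:(M *v h k) $ r:]" for k r
  proof -
    have "R $ k $ r = (\<Sum>s\<in>UNIV. [:h k $ s:] * ((if r = s then [:0, 1:] else 0) - [:M $ r $ s:]))"
      by (simp add: R_def matrix_matrix_mult_def transpose_def Pp_def P_def C_def)
    also have "\<dots> = (\<Sum>s\<in>UNIV. if r = s then [:0, 1:] * [:h k $ s:] else 0)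
        - (\<Sum>s\<in>UNIV. [:M $ r $ s * h k $ s:])"
      by (subst sum_subtractf [symmetric]) (intro sum.cong refl, auto simp: algebra_simps)
    also have "(\<Sum>s\<in>UNIV. [:M $ r $ s * h k $ s:]) = [:(M *v h k) $ r:]"
      by (simp add: matrix_vector_mult_def poly_eq_poly_eq_iff [symmetric] fun_eq_iff poly_sum)
    finally show ?thesis by simp
  qed
  have Ri: "row i R = L *s vp"
    by (simp add: row_def vec_eq_iff Rkr ij Mv L_def vp_def)
  have Rj: "row j R = L *s zp - [:c:] *s vp"
    by (simp add: row_def vec_eq_iff Rkr ij Mz L_def vp_def zp_def)
  define R0 where "R0 = (\<chi> k. if k = i then vp else row k R)"
  have "det R = det (\<chi> k. if k = i then L *s vp else row k R)"
    by (rule arg_cong [of _ _ det]) (simp add: vec_eq_iff Ri [symmetric] row_def)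
  also have "\<dots> = L * det R0"
    by (simp add: det_row_mul R0_def)
  \<comment> \<open>Row \<open>i\<close> of \<open>R0\<close> is \<open>v\<close> itself, its factor
    having been pulled out, so adding \<open>c\<close> times it cancels the term
    \<open>- c v\<close> of row \<open>j\<close> and exposes the second factor.\<close>
  also have "det R0 = det (\<chi> k. if k = j then row j R0 + [:c:] *s row i R0 else row k R0)"
    using \<open>i \<noteq> j\<close> by (intro det_row_operation [symmetric]) auto
  also have "\<dots> = det (\<chi> k. if k = j then L *s zp else row k R0)"
    using \<open>i \<noteq> j\<close> Rj by (intro arg_cong [of _ _ det]) (auto simp: vec_eq_iff row_def R0_def)
  also have "\<dots> = L * det (\<chi> k. if k = j then zp else row k R0)"
    by (simp add: det_row_mul)
  finally have dvd: "L ^ 2 dvd det Pp * charpoly M"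
    by (simp add: detR power2_eq_square mult.assoc)
  \<comment> \<open>The entries of \<open>Pp\<close> are constants, so \<open>det Pp\<close> takes
    the nonzero value \<open>det P\<close> at \<open>\<mu>\<close> and contributes nothing to the
    order there.\<close>
  have "poly (det Pp) \<mu> = det P"
    by (simp add: poly_det Pp_def)
  with \<open>det P \<noteq> 0\<close> have "poly (det Pp) \<mu> \<noteq> 0" by simp
  then have "det Pp \<noteq> 0" "order \<mu> (det Pp) = 0"
    by (auto simp: order_0I)
  show ?thesis
  proof
    assume 1: "order \<mu> (charpoly M) = 1"
    have "order \<mu> (det Pp * charpoly M) = 1"
      using \<open>det Pp \<noteq> 0\<close> \<open>order \<mu> (det Pp) = 0\<close> 1 charpoly_neq_0 [of M] by (simp add: order_mult)
    moreover have "2 \<le> order \<mu> (det Pp * charpoly M)"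
      using dvd charpoly_neq_0 [of M] \<open>det Pp \<noteq> 0\<close> by (simp add: order_divides L_def)
    ultimately show False by simp
  qed
qed

section \<open>Derivative and existence of the perturbed branch\<close>

text \<open>Both conclusions are the first-order terms at \<open>0\<close> of identities valid near
  \<open>0\<close>, and \<open>k\<close> is the derivative of \<open>l\<close> there. Since
  \<open>G\<close> carries the factor \<open>\<epsilon>\<close>, only its value at \<open>v\<close>
  survives. In the application \<open>F\<close> and \<open>G\<close> are the products of
  \<open>lin_comb f A x\<close> and \<open>lin_comb f E x\<close> with \<open>x\<close>.\<close>

lemma eigen_branch_deriv:
  fixes F G :: "'a::euclidean_space \<Rightarrow> 'a" and u :: "real \<Rightarrow> 'a"
  assumes F: "(F has_derivative F') (at v)" and G: "G differentiable (at v)"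
    and u: "(u has_vector_derivative d) (at 0)" and l: "l differentiable (at 0)"
    and 0: "u 0 = v" "l 0 = \<mu>"
    and U: "open U" "0 \<in> U"
    and eq: "\<And>\<epsilon>. \<epsilon> \<in> U \<Longrightarrow> F (u \<epsilon>) + \<epsilon> *\<^sub>R G (u \<epsilon>) = l \<epsilon> *\<^sub>R u \<epsilon>"
    and nrm: "\<And>\<epsilon>. \<epsilon> \<in> U \<Longrightarrow> u \<epsilon> \<bullet> u \<epsilon> = r"
  shows "v \<bullet> d = 0" and "\<exists>k. F' d + G v = \<mu> *\<^sub>R d + k *\<^sub>R v"
proof -
  obtain G' where G': "(G has_derivative G') (at v)"
    using G by (auto simp: differentiable_def)
  obtain k where k: "(l has_real_derivative k) (at 0)"
    using l by (metis real_differentiable_def)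
  have u': "(u has_derivative (\<lambda>e. e *\<^sub>R d)) (at 0)"
    using u by (simp add: has_vector_derivative_def)
  have k': "(l has_derivative (\<lambda>e. k * e)) (at 0)"
    using k by (simp add: has_field_derivative_def)
  have Fu: "((\<lambda>\<epsilon>. F (u \<epsilon>)) has_derivative (\<lambda>e. F' (e *\<^sub>R d))) (at 0)"
    using has_derivative_compose [OF u'] F 0 by simp
  have Gu: "((\<lambda>\<epsilon>. G (u \<epsilon>)) has_derivative (\<lambda>e. G' (e *\<^sub>R d))) (at 0)"
    using has_derivative_compose [OF u'] G' 0 by simp
  have "((\<lambda>\<epsilon>. F (u \<epsilon>) + \<epsilon> *\<^sub>R G (u \<epsilon>) - l \<epsilon> *\<^sub>R u \<epsilon>) has_derivative
      (\<lambda>e. F' (e *\<^sub>R d) + e *\<^sub>R G v - (\<mu> *\<^sub>R e *\<^sub>R d + (k * e) *\<^sub>R v))) (at 0)"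
    by (rule derivative_eq_intros Fu Gu u' k' refl)+ (simp add: 0)
  moreover have "((\<lambda>\<epsilon>. F (u \<epsilon>) + \<epsilon> *\<^sub>R G (u \<epsilon>) - l \<epsilon> *\<^sub>R u \<epsilon>) has_derivative (\<lambda>e. 0)) (at 0)"
    by (rule has_derivative_transform_within_open [OF has_derivative_const [of 0] U]) (simp add: eq)
  ultimately have "(\<lambda>e. F' (e *\<^sub>R d) + e *\<^sub>R G v - (\<mu> *\<^sub>R e *\<^sub>R d + (k * e) *\<^sub>R v)) = (\<lambda>e. 0)"
    by (rule has_derivative_unique)
  from fun_cong [OF this, of 1] show "\<exists>k. F' d + G v = \<mu> *\<^sub>R d + k *\<^sub>R v"
    by (intro exI [of _ k]) simp
  have "((\<lambda>\<epsilon>. u \<epsilon> \<bullet> u \<epsilon>) has_derivative (\<lambda>e. v \<bullet> (e *\<^sub>R d) + (e *\<^sub>R d) \<bullet> v)) (at 0)"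
    by (rule derivative_eq_intros u' refl)+ (simp add: 0)
  moreover have "((\<lambda>\<epsilon>. u \<epsilon> \<bullet> u \<epsilon>) has_derivative (\<lambda>e. 0)) (at 0)"
    by (rule has_derivative_transform_within_open [OF has_derivative_const [of r] U]) (simp add: nrm)
  ultimately have "(\<lambda>e. v \<bullet> (e *\<^sub>R d) + (e *\<^sub>R d) \<bullet> v) = (\<lambda>e. 0)"
    by (rule has_derivative_unique)
  from fun_cong [OF this, of 1] show "v \<bullet> d = 0"
    by (simp add: inner_commute)
qed

text \<open>Together with \<open>v \<noteq> 0\<close>, the kernel condition \<open>ker\<close> makes
  the derivative of the system in the parameter, the vector and the eigenvalue injective at
  \<open>(0, v, \<mu>)\<close>, hence invertible in finite dimension.\<close>

lemma eigen_branch_exists: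
  fixes F G :: "'a::euclidean_space \<Rightarrow> 'a"
  assumes F: "continuously_differentiable_on F S" and G: "continuously_differentiable_on G S"
    and "open S" "v \<in> S" and ev: "F v = \<mu> *\<^sub>R v" and "v \<noteq> 0"
    and F': "(F has_derivative F') (at v)"
    and ker: "\<And>h k. F' h = \<mu> *\<^sub>R h + k *\<^sub>R v \<Longrightarrow> v \<bullet> h = 0 \<Longrightarrow> h = 0"
  obtains U l u where "open U" "0 \<in> U" "l differentiable_on U" "u differentiable_on U"
    "l 0 = \<mu>" "u 0 = v" "\<And>\<epsilon>. \<epsilon> \<in> U \<Longrightarrow> F (u \<epsilon>) + \<epsilon> *\<^sub>R G (u \<epsilon>) = l \<epsilon> *\<^sub>R u \<epsilon>"
    "\<And>\<epsilon>. \<epsilon> \<in> U \<Longrightarrow> u \<epsilon> \<bullet> u \<epsilon> = v \<bullet> v"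
proof -
  obtain DF where DF: "\<And>x. x \<in> S \<Longrightarrow> (F has_derivative blinfun_apply (DF x)) (at x)"
    and cDF: "continuous_on S DF"
    using F by (auto simp: continuously_differentiable_on_def)
  obtain DG where DG: "\<And>x. x \<in> S \<Longrightarrow> (G has_derivative blinfun_apply (DG x)) (at x)"
    and cDG: "continuous_on S DG"
    using G by (auto simp: continuously_differentiable_on_def)
  \<comment> \<open>Keeping \<open>\<epsilon>\<close> as a coordinate turns the implicit function theorem into the inverse one; the
    branch is read off from the preimages of \<open>(\<epsilon>, 0, v \<bullet> v)\<close>.\<close>
  define \<Phi> :: "real \<times> 'a \<times> real \<Rightarrow> real \<times> 'a \<times> real" where
    "\<Phi> = (\<lambda>p. (fst p, F (fst (snd p)) + fst p *\<^sub>R G (fst (snd p)) - snd (snd p) *\<^sub>R fst (snd p),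
              fst (snd p) \<bullet> fst (snd p)))"
  define D :: "real \<times> 'a \<times> real \<Rightarrow> real \<times> 'a \<times> real \<Rightarrow> real \<times> 'a \<times> real" where
    "D = (\<lambda>p q. (fst q,
       DF (fst (snd p)) (fst (snd q)) + (fst p *\<^sub>R DG (fst (snd p)) (fst (snd q)) + fst q *\<^sub>R G (fst (snd p)))
         - (snd (snd p) *\<^sub>R fst (snd q) + snd (snd q) *\<^sub>R fst (snd p)),
       fst (snd p) \<bullet> fst (snd q) + fst (snd q) \<bullet> fst (snd p)))"
  define T :: "(real \<times> 'a \<times> real) set" where "T = UNIV \<times> S \<times> UNIV"
  have "open T" unfolding T_def using \<open>open S\<close> by (intro open_Times) auto
  have D: "(\<Phi> has_derivative D p) (at p)" if "p \<in> T" for p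
  proof -
    have S: "fst (snd p) \<in> S" using that by (auto simp: T_def)
    have pr: "((\<lambda>p. fst (snd p)) has_derivative (\<lambda>q. fst (snd q))) (at p)"
      "((\<lambda>p. snd (snd p)) has_derivative (\<lambda>q. snd (snd q))) (at p)"
      "(fst has_derivative fst) (at p)"
      by (rule derivative_eq_intros refl)+
    have Fp: "((\<lambda>p. F (fst (snd p))) has_derivative (\<lambda>q. DF (fst (snd p)) (fst (snd q)))) (at p)"
      by (rule has_derivative_compose [OF pr(1) DF [OF S]])
    have Gp: "((\<lambda>p. G (fst (snd p))) has_derivative (\<lambda>q. DG (fst (snd p)) (fst (snd q)))) (at p)"
      by (rule has_derivative_compose [OF pr(1) DG [OF S]])
    show ?thesis
      unfolding \<Phi>_def D_def
      by (rule derivative_intros Fp Gp pr)+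
  qed
  then have bl: "bounded_linear (D p)" if "p \<in> T" for p
    using that has_derivative_bounded_linear by blast
  \<comment> \<open>\<open>Blinfun\<close> is meaningful only for bounded linear maps, so
    \<open>D'\<close> agrees with \<open>D\<close> on \<open>T\<close> and is left unspecified
    elsewhere.\<close>
  define D' where "D' p = Blinfun (D p)" for p
  have D': "blinfun_apply (D' p) = D p" if "p \<in> T" for p
    using bl [OF that] by (simp add: D'_def bounded_linear_Blinfun_apply)
  have cont: "continuous_on T D'"
  proof (rule continuous_on_blinfun_componentwise)
    fix q :: "real \<times> 'a \<times> real"
    have fs: "continuous_on T (\<lambda>p. fst (snd p))" "(\<lambda>p. fst (snd p)) ` T \<subseteq> S"
      by (auto simp: T_def intro!: continuous_intros)
    have cG: "continuous_on S G"
      using DG \<open>open S\<close> by (meson continuous_at_imp_continuous_on has_derivative_continuous)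
    have "continuous_on T (\<lambda>p. D p q)"
      unfolding D_def
      by (intro continuous_intros continuous_on_compose2 [OF cDF fs] continuous_on_compose2 [OF cDG fs]
          continuous_on_compose2 [OF cG fs])
    then show "continuous_on T (\<lambda>p. D' p q)"
      by (rule continuous_on_eq) (simp add: D')
  qed
  define p0 where "p0 = (0::real, v, \<mu>)"
  have "p0 \<in> T" using \<open>v \<in> S\<close> by (simp add: p0_def T_def)
  have DFv: "blinfun_apply (DF v) = F'"
    using has_derivative_unique [OF DF [OF \<open>v \<in> S\<close>] F'] .
  have "inj (D p0)"
  proof (rule linear_injective_0 [THEN iffD2], safe)
    show "linear (D p0)" using bl [OF \<open>p0 \<in> T\<close>] by (rule bounded_linear.linear)
    fix e h k assume 0: "D p0 (e, h, k) = 0"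
    \<comment> \<open>The three components of the derivative give the three facts: the first kills
      \<open>e\<close>, and with it the contribution of \<open>G\<close>; the last is twice
      \<open>v \<bullet> h\<close>.\<close>
    then have e: "e = 0" and h1: "F' h = \<mu> *\<^sub>R h + k *\<^sub>R v" and h2: "v \<bullet> h = 0"
      by (auto simp: D_def p0_def DFv inner_commute zero_prod_def)
    have h: "h = 0" using ker [OF h1 h2] .
    with h1 \<open>v \<noteq> 0\<close> have "k = 0"
      using DFv by (metis add_0 blinfun.zero_right scaleR_eq_0_iff scaleR_zero_right)
    with e h show "(e, h, k) = 0" by (simp add: zero_prod_def)
  qed
  then obtain g where g: "linear g" "g \<circ> D p0 = id"
    using linear_injective_left_inverse bl [OF \<open>p0 \<in> T\<close>] bounded_linear.linear by blast
  have "Blinfun g o\<^sub>L D' p0 = id_blinfun"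
    using g D' [OF \<open>p0 \<in> T\<close>]
    by (intro blinfun_eqI) (simp add: bounded_linear_Blinfun_apply linear_conv_bounded_linear pointfree_idE)
  \<comment> \<open>From here on \<open>g\<close> is the local inverse of \<open>\<Phi>\<close>, no
    longer the linear left inverse of \<open>D p0\<close>.\<close>
  then obtain T' W g g' where T': "open T'" "T' \<subseteq> T" "p0 \<in> T'" and W: "open W" "\<Phi> p0 \<in> W"
    and hom: "homeomorphism T' W \<Phi> g"
    and g': "\<And>y. y \<in> W \<Longrightarrow> (g has_derivative (g' y)) (at y)"
    using inverse_function_theorem [OF \<open>open T\<close> _ cont \<open>p0 \<in> T\<close>, of \<Phi>] D D' by metis
  define \<gamma> where "\<gamma> = (\<lambda>\<epsilon>::real. (\<epsilon>, 0::'a, v \<bullet> v))"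
  define U where "U = \<gamma> -` W"
  have cg: "continuous_on UNIV \<gamma>" unfolding \<gamma>_def by (intro continuous_intros)
  have p0: "\<Phi> p0 = \<gamma> 0" by (simp add: \<Phi>_def p0_def \<gamma>_def ev)
  have "open U" unfolding U_def using cg W(1) by (simp add: open_vimage)
  have "0 \<in> U" using W p0 by (simp add: U_def)
  define u l where "u = (\<lambda>\<epsilon>. fst (snd (g (\<gamma> \<epsilon>))))" and "l = (\<lambda>\<epsilon>. snd (snd (g (\<gamma> \<epsilon>))))"
  have "(\<lambda>\<epsilon>. g (\<gamma> \<epsilon>)) differentiable (at \<epsilon>)" if "\<epsilon> \<in> U" for \<epsilon>
  proof -
    have "\<gamma> differentiable (at \<epsilon>)" unfolding \<gamma>_def by (rule differentiableI derivative_intros)+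
    moreover have "g differentiable (at (\<gamma> \<epsilon>))"
      using that g' [of "\<gamma> \<epsilon>"] by (simp add: U_def differentiableI)
    ultimately show ?thesis by (auto simp: differentiable_def intro: has_derivative_compose)
  qed
  then have dU: "(\<lambda>\<epsilon>. g (\<gamma> \<epsilon>)) differentiable_on U"
    by (simp add: differentiable_at_imp_differentiable_on)
  have "l differentiable_on U" unfolding l_def
    by (rule differentiable_on_compose [OF dU bounded_linear_imp_differentiable_on
        [OF bounded_linear_compose [OF bounded_linear_snd bounded_linear_snd]]])
  moreover have "u differentiable_on U" unfolding u_def
    by (rule differentiable_on_compose [OF dU bounded_linear_imp_differentiable_on
        [OF bounded_linear_compose [OF bounded_linear_fst bounded_linear_snd]]])
  moreover have "g (\<gamma> 0) = p0"
    using hom T' p0 by (metis homeomorphism_def)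
  then have "l 0 = \<mu>" "u 0 = v" by (simp_all add: u_def l_def p0_def)
  moreover have "F (u \<epsilon>) + \<epsilon> *\<^sub>R G (u \<epsilon>) = l \<epsilon> *\<^sub>R u \<epsilon>" "u \<epsilon> \<bullet> u \<epsilon> = v \<bullet> v" if "\<epsilon> \<in> U" for \<epsilon>
  proof -
    have \<Phi>: "\<Phi> (g (\<gamma> \<epsilon>)) = (\<epsilon>, 0, v \<bullet> v)"
      using hom that by (simp add: homeomorphism_def U_def \<gamma>_def)
    \<comment> \<open>The first component of \<open>\<Phi>\<close> copies the parameter, so the
      preimage solves the equation for this very \<open>\<epsilon>\<close>.\<close>
    then have "fst (g (\<gamma> \<epsilon>)) = \<epsilon>" by (simp add: \<Phi>_def)
    with \<Phi> show "F (u \<epsilon>) + \<epsilon> *\<^sub>R G (u \<epsilon>) = l \<epsilon> *\<^sub>R u \<epsilon>" "u \<epsilon> \<bullet> u \<epsilon> = v \<bullet> v"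
      by (simp_all add: \<Phi>_def u_def l_def)
  qed
  ultimately show ?thesis
    using that [of U l u] \<open>open U\<close> \<open>0 \<in> U\<close> by blast
qed

section \<open>Products of matrix combinations with vectors, and their smoothness\<close>

lemma matrix_vector_mult_scaleR_left: "(c *\<^sub>R M) *v x = c *\<^sub>R (M *v x)" for M :: "real^'n^'m"
  by (simp add: scaleR_matrix_vector_assoc)

lemma lin_comb_mult: "lin_comb f B x *v y = (\<Sum>i\<in>UNIV. f i x *\<^sub>R (B i *v y))"
proof -
  have "(\<Sum>i\<in>I. f i x *\<^sub>R B i) *v y = (\<Sum>i\<in>I. f i x *\<^sub>R (B i *v y))" if "finite I" for I
    using that by (induction I)
      (simp_all add: matrix_vector_mult_add_rdistrib matrix_vector_mult_scaleR_left)
  then show ?thesis by (simp add: lin_comb_def)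
qed

text \<open>Product rule, followed by continuity of the derivative in each fixed direction, which
  suffices in finite dimension. It serves both \<open>A\<close> and the perturbations
  \<open>E\<close>, as they share the coefficients \<open>f i\<close>.\<close>

lemma continuously_differentiable_on_lin_comb_mult:
  fixes f :: "'m::finite \<Rightarrow> real^'n \<Rightarrow> real"
  assumes f: "\<And>i. continuously_differentiable_on (f i) S"
  shows "continuously_differentiable_on (\<lambda>x. lin_comb f B x *v x) S"
proof -
  have "\<forall>i. \<exists>f'. (\<forall>x\<in>S. (f i has_derivative blinfun_apply (f' x)) (at x)) \<and> continuous_on S f'"
    using f unfolding continuously_differentiable_on_def by blast
  then obtain f' where f': "\<And>i x. x \<in> S \<Longrightarrow> (f i has_derivative blinfun_apply (f' i x)) (at x)"
    and cf': "\<And>i. continuous_on S (f' i)"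
    by metis
  have cf: "continuous_on S (f i)" for i
    using f' by (meson continuous_at_imp_continuous_on has_derivative_continuous)
  have B: "bounded_linear ((*v) (B i))" for i
    by (rule matrix_vector_mul_bounded_linear)
  define D where "D x h = (\<Sum>i\<in>UNIV. f i x *\<^sub>R (B i *v h) + f' i x h *\<^sub>R (B i *v x))" for x h
  have D: "((\<lambda>x. lin_comb f B x *v x) has_derivative D x) (at x)" if "x \<in> S" for x
    unfolding lin_comb_mult D_def
    by (rule has_derivative_sum has_derivative_scaleR f' that bounded_linear.has_derivative [OF B]
        has_derivative_ident)+
  have ap: "blinfun_apply (Blinfun (D x)) = D x" if "x \<in> S" for x
    using D [OF that] by (intro bounded_linear_Blinfun_apply has_derivative_bounded_linear)
  have "continuous_on S (\<lambda>x. Blinfun (D x))"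
  proof (rule continuous_on_blinfun_componentwise)
    fix h
    have "continuous_on S (\<lambda>x. D x h)"
      unfolding D_def by (intro continuous_intros cf cf' linear_continuous_on B)
    then show "continuous_on S (\<lambda>x. blinfun_apply (Blinfun (D x)) h)"
      by (rule continuous_on_eq) (simp add: ap)
  qed
  with D ap show ?thesis
    unfolding continuously_differentiable_on_def
    by (intro exI [of _ "\<lambda>x. Blinfun (D x)"]) simp
qed

section \<open>Matrix norms and the supremum over perturbations\<close>

definition outer :: "real^'m \<Rightarrow> real^'n \<Rightarrow> real^'n^'m" where
  "outer x y = (\<chi> i j. x $ i * y $ j)"

lemma outer_mult: "outer x y *v z = (y \<bullet> z) *\<^sub>R x"
  by (simp add: outer_def vec_eq_iff matrix_vector_mult_def inner_vec_def sum_distrib_left algebra_simps)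

lemma frobenius_norm_outer: "frobenius_norm (outer x y) = norm x * norm y"
  by (simp add: frobenius_norm_def outer_def norm_vec_def L2_set_def power_mult_distrib
      sum_distrib_left [symmetric] sum_distrib_right [symmetric] real_sqrt_mult)

text \<open>Cauchy-Schwarz for each row of \<open>M\<close>, then the Euclidean norm over the
  rows.\<close>

lemma spectral_norm_le_frobenius_norm: "spectral_norm M \<le> frobenius_norm M"
  for M :: "real^'n^'m"
  unfolding spectral_norm_def
proof (rule onorm_le)
  fix x
  have "norm (M *v x) = L2_set (\<lambda>i. \<bar>(M *v x) $ i\<bar>) UNIV"
    by (simp add: norm_vec_def)
  also have "\<dots> \<le> L2_set (\<lambda>i. norm (M $ i) * norm x) UNIV"
    by (intro L2_set_mono) (simp_all add: matrix_vector_mul_component Cauchy_Schwarz_ineq2)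
  also have "\<dots> = frobenius_norm M * norm x"
    by (simp add: frobenius_norm_eq_norm norm_vec_def [of M] L2_set_left_distrib)
  finally show "norm (M *v x) \<le> frobenius_norm M * norm x" .
qed

lemma norm_matrix_vector_mult_le: "norm (M *v x) \<le> spectral_norm M * norm x"
  for M :: "real^'n^'m"
  unfolding spectral_norm_def by (rule onorm [OF matrix_vector_mul_bounded_linear])

text \<open>Compactness of the unit sphere gives a maximizer, and homogeneity extends its bound to
  all vectors.\<close>

lemma spectral_norm_attained:
  fixes K :: "real^'n^'m"
  obtains x where "norm x = 1" "norm (K *v x) = spectral_norm K"
proof -
  have "sphere (0::real^'n) 1 \<noteq> {}" by simp
  moreover have "continuous_on (sphere 0 1) (\<lambda>x. norm (K *v x))"
    by (intro continuous_intros linear_continuous_on matrix_vector_mul_bounded_linear)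
  ultimately obtain x where x: "norm x = 1"
    and max: "\<And>y. norm y = 1 \<Longrightarrow> norm (K *v y) \<le> norm (K *v x)"
    using continuous_attains_sup [OF compact_sphere, of 0 1 "\<lambda>x. norm (K *v x)"] by auto
  have "spectral_norm K \<le> norm (K *v x)"
    unfolding spectral_norm_def
  proof (rule onorm_le)
    fix y
    show "norm (K *v y) \<le> norm (K *v x) * norm y"
    proof (cases "y = 0")
      case False
      have "K *v y = norm y *\<^sub>R (K *v (y /\<^sub>R norm y))"
        using False by (simp add: matrix_vector_mult_scaleR)
      then have "norm (K *v y) = norm y * norm (K *v (y /\<^sub>R norm y))"
        by (metis abs_norm_cancel norm_scaleR)
      also have "\<dots> \<le> norm y * norm (K *v x)"
        using False by (intro mult_left_mono max) auto
      finally show ?thesis by (simp add: mult.commute)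
    qed simp
  qed
  with norm_matrix_vector_mult_le [of K x] x that show ?thesis by force
qed

text \<open>The Frobenius ball lies in the spectral ball, so the upper bound is proved on the larger
  ball and the extremal matrices are taken from the smaller one; this settles both norms at once. An
  arbitrary \<open>K\<close> covers dimension one through \<open>K = 0\<close>.\<close>

lemma eigvec_cond_eq_spectral_norm:
  fixes K :: "real^'n^'n" and w :: "'m::finite \<Rightarrow> real"
  assumes deriv: "\<And>E. eigvec_deriv f A E \<mu> v = - (K *v (lin_comb f E v *v v))"
    and "v \<noteq> 0" and w: "\<And>i. w i \<ge> 0" and N: "N = spectral_norm \<or> N = frobenius_norm"
  shows "eigvec_cond N w f A \<mu> v = ereal (spectral_norm K * (\<Sum>i\<in>UNIV. \<bar>f i v\<bar> * w i))"
  unfolding eigvec_cond_def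
proof (rule Sup_eqI, safe)
  fix E assume E: "\<forall>i. N (E i) \<le> w i"
  have "spectral_norm (E i) \<le> w i" for i
    using E N spectral_norm_le_frobenius_norm [of "E i"] by (auto intro: order_trans)
  then have Ev: "norm (E i *v v) \<le> w i * norm v" for i
    by (meson mult_right_mono norm_ge_zero norm_matrix_vector_mult_le order_trans)
  have K0: "0 \<le> spectral_norm K"
    unfolding spectral_norm_def by (rule onorm_pos_le [OF matrix_vector_mul_bounded_linear])
  have "norm (eigvec_deriv f A E \<mu> v) \<le> spectral_norm K * norm (lin_comb f E v *v v)"
    by (simp add: deriv norm_matrix_vector_mult_le)
  also have "norm (lin_comb f E v *v v) \<le> (\<Sum>i\<in>UNIV. \<bar>f i v\<bar> * (w i * norm v))"
    unfolding lin_comb_mult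
    by (rule sum_norm_le) (simp add: Ev mult_left_mono)
  also have "\<dots> = (\<Sum>i\<in>UNIV. \<bar>f i v\<bar> * w i) * norm v"
    by (simp add: sum_distrib_right mult.assoc)
  finally have "norm (eigvec_deriv f A E \<mu> v) \<le> (spectral_norm K * (\<Sum>i\<in>UNIV. \<bar>f i v\<bar> * w i)) * norm v"
    using K0 by (simp add: mult_left_mono mult.assoc)
  then show "ereal (norm (eigvec_deriv f A E \<mu> v) / norm v)
      \<le> ereal (spectral_norm K * (\<Sum>i\<in>UNIV. \<bar>f i v\<bar> * w i))"
    using \<open>v \<noteq> 0\<close> by (simp add: divide_le_eq)
next
  fix y
  assume y: "\<And>z. z \<in> {ereal (norm (eigvec_deriv f A E \<mu> v) / norm v) |E. \<forall>i. N (E i) \<le> w i} \<Longrightarrow> z \<le> y"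
  obtain x where x: "norm x = 1" "norm (K *v x) = spectral_norm K"
    using spectral_norm_attained .
  \<comment> \<open>The sign aligns every \<open>f i v *\<^sub>R (E i *v v)\<close> with
    \<open>x\<close>, so that no cancellation occurs in the sum. Dividing by \<open>norm v\<close>
    gives \<open>E i\<close> norm \<open>w i\<close>, or \<open>0\<close> where \<open>f i v\<close>
    vanishes.\<close>
  define E where "E i = outer ((sgn (f i v) * w i / norm v) *\<^sub>R x) v" for i
  define s where "s = (\<Sum>i\<in>UNIV. \<bar>f i v\<bar> * w i)"
  have "frobenius_norm (E i) \<le> w i" for i
    using w [of i] \<open>v \<noteq> 0\<close> by (simp add: E_def frobenius_norm_outer x abs_mult abs_sgn_eq)
  then have "\<forall>i. N (E i) \<le> w i"
    using N spectral_norm_le_frobenius_norm by (metis order_trans)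
  moreover have "lin_comb f E v *v v = (s * norm v) *\<^sub>R x"
    using \<open>v \<noteq> 0\<close> unfolding lin_comb_mult s_def sum_distrib_right scaleR_left.sum
    by (intro sum.cong) (simp_all add: E_def outer_mult dot_square_norm power2_eq_square abs_sgn algebra_simps)
  then have "norm (eigvec_deriv f A E \<mu> v) = \<bar>s * norm v\<bar> * spectral_norm K"
    by (simp add: deriv matrix_vector_mult_scaleR x)
  moreover have "0 \<le> s" using w by (simp add: s_def sum_nonneg)
  ultimately have "ereal (spectral_norm K * s) \<le> y"
    using \<open>v \<noteq> 0\<close> by (intro y CollectI exI [of _ E]) (simp add: abs_mult)
  then show "ereal (spectral_norm K * (\<Sum>i\<in>UNIV. \<bar>f i v\<bar> * w i)) \<le> y"
    by (simp add: s_def)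
qed

section \<open>The eigenvector derivative at a simple eigenpair\<close>

text \<open>A nonzero \<open>z\<close> orthogonal to \<open>v\<close> would be independent of it,
  and the pair would contradict multiplicity one.\<close>

lemma simple_eigen_kernel:
  fixes M :: "real^'n^'n"
  assumes "order \<mu> (charpoly M) = 1" and Mv: "M *v v = \<mu> *\<^sub>R v" and "v \<noteq> 0"
    and Mz: "M *v z = \<mu> *\<^sub>R z + c *\<^sub>R v" and orth: "v \<bullet> z = 0"
  shows "z = 0"
proof (rule ccontr)
  assume "z \<noteq> 0"
  with \<open>v \<noteq> 0\<close> orth have "v \<noteq> z" by auto
  moreover have "independent {v, z}"
    by (rule pairwise_orthogonal_independent)
      (use \<open>v \<noteq> 0\<close> \<open>z \<noteq> 0\<close> orth in \<open>auto simp: pairwise_def orthogonal_def inner_commute\<close>)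
  ultimately show False
    using order_charpoly_neq_1 [OF Mv Mz] assms(1) by blast
qed

lemma has_derivative_eig_jacobian:
  assumes "continuously_differentiable_on (\<lambda>x. A x *v x) S" "v \<in> S"
  shows "((\<lambda>x. A x *v x) has_derivative (\<lambda>h. eig_jacobian A v *v h)) (at v)"
  unfolding eig_jacobian_def
  using assms by (subst jacobian_works [symmetric]) (auto simp: continuously_differentiable_on_def differentiable_def)

lemma perturbed_branch_alt:
  "perturbed_branch f A E \<mu> v U l u \<longleftrightarrow>
     open U \<and> 0 \<in> U \<and> l differentiable_on U \<and> u differentiable_on U \<and> l 0 = \<mu> \<and> u 0 = v \<and>
     (\<forall>\<epsilon>\<in>U. lin_comb f A (u \<epsilon>) *v u \<epsilon> + \<epsilon> *\<^sub>R (lin_comb f E (u \<epsilon>) *v u \<epsilon>) = l \<epsilon> *\<^sub>R u \<epsilon> \<and>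
            u \<epsilon> \<bullet> u \<epsilon> = 2)"
  by (simp add: perturbed_branch_def matrix_vector_mult_add_rdistrib matrix_vector_mult_scaleR_left)

text \<open>As \<open>eigvec_deriv\<close> is a definite description, its value is usable only after
  existence and uniqueness are shown. A branch exists by the inverse function theorem. Any two
  candidate derivatives, possibly from different branches, solve the same linear system, and their
  difference lies in the trivial kernel.\<close>

lemma eigvec_deriv_linear_system:
  fixes f :: "'m::finite \<Rightarrow> real^'n \<Rightarrow> real"
  assumes f: "\<And>i. continuously_differentiable_on (f i) (UNIV - {0})"
    and simple: "simple_eigenpair (lin_comb f A) \<mu> v"
    and nv: "v \<bullet> v = 2"
  shows "v \<bullet> eigvec_deriv f A E \<mu> v = 0"
    and "\<exists>k. eig_jacobian (lin_comb f A) v *v eigvec_deriv f A E \<mu> v + lin_comb f E v *v v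
             = \<mu> *\<^sub>R eigvec_deriv f A E \<mu> v + k *\<^sub>R v"
proof -
  define J where "J = eig_jacobian (lin_comb f A) v"
  have "v \<noteq> 0" and ev: "lin_comb f A v *v v = \<mu> *\<^sub>R v" and Jv: "J *v v = \<mu> *\<^sub>R v"
    and ord: "order \<mu> (charpoly J) = 1"
    using simple by (auto simp: simple_eigenpair_def eigenpair_def J_def)
  note ker = simple_eigen_kernel [OF ord Jv \<open>v \<noteq> 0\<close>]
  note CD = continuously_differentiable_on_lin_comb_mult [of f, OF f]
  have vS: "v \<in> UNIV - {0}" using \<open>v \<noteq> 0\<close> by simp
  have dA: "((\<lambda>x. lin_comb f A x *v x) has_derivative (\<lambda>h. J *v h)) (at v)"
    unfolding J_def by (rule has_derivative_eig_jacobian [OF CD vS])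
  have dE: "(\<lambda>x. lin_comb f E x *v x) differentiable (at v)"
    using CD [of E] vS by (auto simp: continuously_differentiable_on_def differentiable_def)
  let ?P = "\<lambda>d. \<exists>U l u. perturbed_branch f A E \<mu> v U l u \<and> (u has_vector_derivative d) (at 0)"
  have P: "v \<bullet> d = 0 \<and> (\<exists>k. J *v d + lin_comb f E v *v v = \<mu> *\<^sub>R d + k *\<^sub>R v)" if Pd: "?P d" for d
  proof -
    obtain U l u where br: "perturbed_branch f A E \<mu> v U l u" and u: "(u has_vector_derivative d) (at 0)"
      using Pd by blast
    from br have "l differentiable (at 0)"
      unfolding perturbed_branch_def by (metis at_within_open differentiable_on_def)
    then show ?thesis
      using eigen_branch_deriv [OF dA dE u, of l \<mu> U 2] br
      by (simp add: perturbed_branch_alt)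
  qed
  have "\<exists>d. ?P d"
  proof -
    obtain U l u where U: "open U" "0 \<in> U" "l differentiable_on U" "u differentiable_on U"
      "l 0 = \<mu>" "u 0 = v"
      "\<And>\<epsilon>. \<epsilon> \<in> U \<Longrightarrow> lin_comb f A (u \<epsilon>) *v u \<epsilon> + \<epsilon> *\<^sub>R (lin_comb f E (u \<epsilon>) *v u \<epsilon>) = l \<epsilon> *\<^sub>R u \<epsilon>"
      "\<And>\<epsilon>. \<epsilon> \<in> U \<Longrightarrow> u \<epsilon> \<bullet> u \<epsilon> = v \<bullet> v"
      by (rule eigen_branch_exists [OF CD [of A] CD [of E] open_delete [OF open_UNIV] vS ev
            \<open>v \<noteq> 0\<close> dA ker]) blast+
    then have "perturbed_branch f A E \<mu> v U l u" by (simp add: perturbed_branch_alt nv)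
    moreover have "u differentiable (at 0)"
      using U by (metis at_within_open differentiable_on_def)
    ultimately show ?thesis by (meson vector_derivative_works)
  qed
  then obtain d where d: "?P d" ..
  have "eigvec_deriv f A E \<mu> v = d"
    unfolding eigvec_deriv_def
  proof (rule the_equality)
    show "?P d" by (fact d)
    fix d' assume "?P d'"
    then obtain k' where 1: "v \<bullet> d' = 0" "J *v d' + lin_comb f E v *v v = \<mu> *\<^sub>R d' + k' *\<^sub>R v"
      using P by blast
    obtain k where 2: "v \<bullet> d = 0" "J *v d + lin_comb f E v *v v = \<mu> *\<^sub>R d + k *\<^sub>R v"
      using P [OF d] by blast
    have "J *v (d' - d) = \<mu> *\<^sub>R (d' - d) + (k' - k) *\<^sub>R v"
    proof -
      have "J *v (d' - d) = (J *v d' + lin_comb f E v *v v) - (J *v d + lin_comb f E v *v v)"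
        by (simp add: matrix_vector_mult_diff_distrib)
      then show ?thesis by (simp only: 1(2) 2(2)) (simp add: algebra_simps)
    qed
    moreover have "v \<bullet> (d' - d) = 0" using 1 2 by (simp add: inner_diff_right)
    ultimately have "d' - d = 0" by (rule ker)
    then show "d' = d" by simp
  qed
  with P [OF d] show "v \<bullet> eigvec_deriv f A E \<mu> v = 0"
    "\<exists>k. eig_jacobian (lin_comb f A) v *v eigvec_deriv f A E \<mu> v + lin_comb f E v *v v
         = \<mu> *\<^sub>R eigvec_deriv f A E \<mu> v + k *\<^sub>R v"
    by (simp_all add: J_def)
qed

section \<open>Compression to the orthogonal complement of the eigenvector\<close>

text \<open>Orthogonality of the columns gives one inclusion; equality follows because both
  subspaces have dimension \<open>CARD('n) - 1\<close>.\<close>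

lemma range_eq_orthogonal_complement:
  fixes V :: "real^'k^'n"
  assumes n: "CARD('n) = CARD('k) + 1" and "rank V = CARD('k)" and "v \<noteq> 0"
    and orth: "\<And>j. column j V \<bullet> v = 0"
  shows "range ((*v) V) = {z. v \<bullet> z = 0}"
proof (rule subspace_dim_equal)
  show "subspace (range ((*v) V))"
    by (simp add: linear_subspace_image)
  show "subspace {z. v \<bullet> z = 0}" by (rule subspace_hyperplane)
  show "range ((*v) V) \<subseteq> {z. v \<bullet> z = 0}"
  proof safe
    fix y
    have "v \<bullet> (V *v y) = (\<Sum>j\<in>UNIV. y $ j * (column j V \<bullet> v))"
      by (simp add: matrix_mult_sum inner_sum_right scalar_mult_eq_scaleR inner_commute)
    then show "v \<bullet> (V *v y) = 0" by (simp add: orth)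
  qed
  show "dim {z. v \<bullet> z = 0} \<le> dim (range ((*v) V))"
    using assms dim_hyperplane [OF \<open>v \<noteq> 0\<close>] by (simp add: rank_dim_range)
qed

text \<open>Since \<open>transpose V\<close> annihilates \<open>v\<close>, applying it to
  \<open>B *v d + b = k *\<^sub>R v\<close> removes the unknown \<open>k\<close>. With
  \<open>d = V *v y\<close> a square system for \<open>y\<close> remains. It is applied with
  \<open>B = J - mat \<mu>\<close>.\<close>

lemma compressed_inverse:
  fixes V :: "real^'k^'n" and B :: "real^'n^'n"
  assumes range: "range ((*v) V) = {z. v \<bullet> z = 0}" and inj: "inj ((*v) V)"
    and ker: "\<And>z k. B *v z = k *\<^sub>R v \<Longrightarrow> v \<bullet> z = 0 \<Longrightarrow> z = 0"
    and d: "v \<bullet> d = 0" "B *v d + b = k *\<^sub>R v"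
  shows "d = - ((V ** matrix_inv (transpose V ** B ** V) ** transpose V) *v b)"
proof -
  define M where "M = transpose V ** B ** V"
  have Vv: "transpose V *v v = 0"
  proof -
    have "(transpose V *v v) \<bullet> y = 0" for y
      using range by (simp add: dot_lmul_matrix set_eq_iff) blast
    then show ?thesis by (metis inner_eq_zero_iff)
  qed
  have "inj ((*v) M)"
  proof (rule linear_injective_0 [THEN iffD2, rule_format])
    fix y assume "M *v y = 0"
    then have 0: "transpose V *v (B *v (V *v y)) = 0"
      by (simp add: M_def matrix_vector_mul_assoc matrix_mul_assoc)
    define p where "p = B *v (V *v y)"
    \<comment> \<open>This is the coefficient of the orthogonal projection of \<open>p\<close> onto
      \<open>v\<close>. The remainder lies in the range of \<open>V\<close> and, by the assumption
      on \<open>y\<close>, is orthogonal to that range, so it vanishes.\<close>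
    define k where "k = (v \<bullet> p) / (v \<bullet> v)"
    have "v \<bullet> (p - k *\<^sub>R v) = 0"
      by (simp add: k_def inner_diff_right)
    then obtain x where x: "p - k *\<^sub>R v = V *v x" using range by blast
    have "transpose V *v (p - k *\<^sub>R v) = 0"
      using 0 Vv by (simp add: p_def matrix_vector_mult_diff_distrib matrix_vector_mult_scaleR)
    then have "(p - k *\<^sub>R v) \<bullet> (V *v x) = 0"
      by (simp add: dot_lmul_matrix [symmetric])
    then have "p = k *\<^sub>R v" using x by simp
    moreover have "v \<bullet> (V *v y) = 0" using range by blast
    ultimately have "V *v y = 0" using ker [of "V *v y" k] p_def by simp
    then show "y = 0" using inj by (metis injD matrix_vector_mult_0_right)
  qed (rule matrix_vector_mul_linear)
  then have "invertible M"
    by (simp add: invertible_left_inverse matrix_left_invertible_injective)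
  \<comment> \<open>\<open>matrix_inv\<close> is defined by choice and acts as an inverse only once
    invertibility is established.\<close>
  then have inv: "matrix_inv M ** M = mat 1"
    unfolding invertible_def matrix_inv_def by (rule someI2_ex) simp
  obtain y where y: "d = V *v y" using range d by blast
  have "B *v (V *v y) = k *\<^sub>R v - b"
    using d(2) by (simp add: y eq_diff_eq)
  then have "M *v y = transpose V *v (k *\<^sub>R v - b)"
    by (simp add: M_def matrix_vector_mul_assoc [symmetric])
  then have "M *v y = - (transpose V *v b)"
    by (simp add: matrix_vector_mult_diff_distrib matrix_vector_mult_scaleR Vv [simplified])
  then have "matrix_inv M *v (M *v y) = - (matrix_inv M *v (transpose V *v b))"
    by (simp add: linear_neg [OF matrix_vector_mul_linear])
  then have "y = - (matrix_inv M *v (transpose V *v b))"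
    by (simp add: matrix_vector_mul_assoc inv)
  then show ?thesis
    by (simp add: y M_def [symmetric] linear_neg [OF matrix_vector_mul_linear] matrix_vector_mul_assoc [symmetric])
qed

(* V ranges over n x (n-1) matrices, with n = CARD('n) and n - 1 = CARD('k).  Types are nonempty,
   so n = 1 is the second conjunct: there V has no columns and the product
   V (V^T (J - lambda I) V)^(-1) V^T is the 1 x 1 zero matrix. *)
theorem theorem3p8:
  fixes f :: "'m::finite \<Rightarrow> real^'n \<Rightarrow> real"
    and A :: "'m \<Rightarrow> real^'n^'n"
    and w :: "'m \<Rightarrow> real"
    and \<mu> :: real and v :: "real^'n"
    and N :: "real^'n^'n \<Rightarrow> real"
  assumes "\<And>i. transpose (A i) = A i"
    and "\<And>i. scaling_invariant (f i)"
    and "\<And>i. continuously_differentiable_on (f i) (UNIV - {0})"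
    and "simple_eigenpair (lin_comb f A) \<mu> v"
    and "(v \<bullet> v) / 2 = 1"
    and "\<And>i. w i \<ge> 0"
    and "N = spectral_norm \<or> N = frobenius_norm"
  shows "(\<forall>V :: real^'k^'n.
            CARD('n) = CARD('k) + 1 \<longrightarrow> rank V = CARD('k) \<longrightarrow> (\<forall>j. column j V \<bullet> v = 0) \<longrightarrow>
            eigvec_cond N w f A \<mu> v =
              ereal (spectral_norm
                  (V ** matrix_inv (transpose V ** (eig_jacobian (lin_comb f A) v - mat \<mu>) ** V)
                     ** transpose V)
                * (\<Sum>i\<in>UNIV. \<bar>f i v\<bar> * w i)))
       \<and> (CARD('n) = 1 \<longrightarrow>
            eigvec_cond N w f A \<mu> v =
              ereal (spectral_norm (0 :: real^'n^'n) * (\<Sum>i\<in>UNIV. \<bar>f i v\<bar> * w i)))"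
proof (intro conjI allI impI)
  define J where "J = eig_jacobian (lin_comb f A) v"
  have vv: "v \<bullet> v = 2" and "v \<noteq> 0" and Jv: "J *v v = \<mu> *\<^sub>R v" and ord: "order \<mu> (charpoly J) = 1"
    using assms(4,5) by (auto simp: J_def simple_eigenpair_def eigenpair_def)
  note system = eigvec_deriv_linear_system [of f A \<mu> v, OF assms(3,4) vv]
  note cond = eigvec_cond_eq_spectral_norm [OF _ \<open>v \<noteq> 0\<close> assms(6,7)]
  {
    fix V :: "real^'k^'n"
    assume n: "CARD('n) = CARD('k) + 1" and rank: "rank V = CARD('k)"
      and orth: "\<forall>j. column j V \<bullet> v = 0"
    have ker: "z = 0" if "(J - mat \<mu>) *v z = k *\<^sub>R v" "v \<bullet> z = 0" for z k
      using simple_eigen_kernel [OF ord Jv \<open>v \<noteq> 0\<close> _ that(2), of k] that(1)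
      by (simp add: matrix_vector_mult_diff_rdistrib mat_vector_mult algebra_simps)
    show "eigvec_cond N w f A \<mu> v =
              ereal (spectral_norm
                  (V ** matrix_inv (transpose V ** (eig_jacobian (lin_comb f A) v - mat \<mu>) ** V)
                     ** transpose V)
                * (\<Sum>i\<in>UNIV. \<bar>f i v\<bar> * w i))"
      unfolding J_def [symmetric]
    proof (rule cond)
      fix E
      obtain k where "J *v eigvec_deriv f A E \<mu> v + lin_comb f E v *v v
          = \<mu> *\<^sub>R eigvec_deriv f A E \<mu> v + k *\<^sub>R v"
        using system(2) J_def by blast
      then have "(J - mat \<mu>) *v eigvec_deriv f A E \<mu> v + lin_comb f E v *v v = k *\<^sub>R v"
        by (simp add: matrix_vector_mult_diff_rdistrib mat_vector_mult algebra_simps)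
      with system(1) show "eigvec_deriv f A E \<mu> v =
          - ((V ** matrix_inv (transpose V ** (J - mat \<mu>) ** V) ** transpose V) *v (lin_comb f E v *v v))"
        using n rank orth \<open>v \<noteq> 0\<close> ker
        by (intro compressed_inverse range_eq_orthogonal_complement) (auto simp: full_rank_injective)
    qed
  }
  \<comment> \<open>The complement of \<open>v\<close> is now trivial, so orthogonality alone forces
    every eigenvector derivative to be zero, and \<open>cond\<close> applies with
    \<open>K = 0\<close>.\<close>
  assume "CARD('n) = 1"
  then have "dim {z. v \<bullet> z = 0} = 0"
    using dim_hyperplane [OF \<open>v \<noteq> 0\<close>] by simp
  then have "eigvec_deriv f A E \<mu> v = 0" for E
    using system(1) [of E] by (auto simp: dim_eq_0)
  then show "eigvec_cond N w f A \<mu> v =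
              ereal (spectral_norm (0 :: real^'n^'n) * (\<Sum>i\<in>UNIV. \<bar>f i v\<bar> * w i))"
    by (intro cond) simp
qed

end
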